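(* Let $0\le\sigma_1,\sigma_2<1$ and let $g(z)=1+\sigma_1z_1^2+\sigma_2z_2^2$ on $\mathbb C^2$. There exist an integer $N$ and a holomorphic polynomial map $P\colon\mathbb C^2\to\mathbb C^N$, with $P(0)=0$ and $\deg P=3$, such that $P/g$ is a reduced sphere map, if and only if \[ 0\le\sigma_1,\sigma_2<1,\qquad \sqrt{1-\sigma_1^2}+\sqrt{1-\sigma_2^2}>1 . \]
   Context: $\mathbb B^n$ is the open unit ball of $\mathbb C^n$ and $\|\cdot\|$ the Euclidean norm. A (rational) sphere map in $n$ variables is a rational map $F=P/g$, holomorphic on $\mathbb B^n$, where $P=(p_1,\dots,p_N)^t\colon\mathbb C^n\to\mathbb C^N$ is a polynomial map and $g$ a scalar polynomial, satisfying the sphere identity $\|P(z)\|^2=|g(z)|^2$ for all $z\in\partial\mathbb B^n$. The representation $P/g$ is reduced if $g,p_1,\dots,p_N$ have no common nonconstant polynomial factor. $\deg P$ is the maximum of the degrees of the components of $P$. *)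

theory Defs
  imports "HOL-Analysis.Analysis" "HOL-Computational_Algebra.Computational_Algebra"
begin

text \<open>
  The polynomial ring \<open>\<complex>[z\<^sub>1,z\<^sub>2]\<close> is represented as \<open>\<complex>[z\<^sub>1][z\<^sub>2]\<close>, that is, by the type
  \<^typ>\<open>complex poly poly\<close>: the outer indeterminate is \<open>z\<^sub>2\<close>, the inner one is \<open>z\<^sub>1\<close>, and
  \<open>coeff (coeff p j) i\<close> is the coefficient of \<open>z\<^sub>1^i * z\<^sub>2^j\<close>. The space \<open>\<complex>\<^sup>2\<close> is
  \<^typ>\<open>complex \<times> complex\<close>, whose library norm is the Euclidean one. A polynomial map into
  \<open>\<complex>\<^sup>N\<close> is a family \<open>P :: nat \<Rightarrow> complex poly poly\<close> of which only the components \<open>P k\<close> with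
  \<open>k < N\<close> matter.
\<close>

definition Z1 :: "complex poly poly" where
  "Z1 = [:[:0, 1:]:]"

definition Z2 :: "complex poly poly" where
  "Z2 = [:0, 1:]"

definition Const :: "complex \<Rightarrow> complex poly poly" where
  "Const c = [:[:c:]:]"

definition eval2 :: "complex poly poly \<Rightarrow> complex \<times> complex \<Rightarrow> complex" where
  "eval2 p z = poly (poly p [:snd z:]) (fst z)"

lemma eval2_simps:
  "eval2 Z1 z = fst z" "eval2 Z2 z = snd z" "eval2 (Const c) z = c"
  "eval2 0 z = 0" "eval2 1 z = 1"
  "eval2 (p + q) z = eval2 p z + eval2 q z"
  "eval2 (p * q) z = eval2 p z * eval2 q z"
  "eval2 (p ^ n) z = eval2 p z ^ n"
  by (simp_all add: eval2_def Z1_def Z2_def Const_def)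

text \<open>The zero polynomial gets degree 0, as with \<^const>\<open>degree\<close>.\<close>

definition total_degree :: "complex poly poly \<Rightarrow> nat" where
  "total_degree p = Max (insert 0 {i + j | i j. coeff (coeff p j) i \<noteq> 0})"

lemma finite_total_degree: "finite {i + j | i j. coeff (coeff p j) i \<noteq> 0}"
  for p :: "complex poly poly"
proof (rule finite_subset)
  show "{i + j | i j. coeff (coeff p j) i \<noteq> 0}
      \<subseteq> (\<Union>j\<le>degree p. (\<lambda>i. i + j) ` {..degree (coeff p j)})"
  proof clarify
    fix i j assume nz: "coeff (coeff p j) i \<noteq> 0"
    then have "j \<le> degree p" by (metis coeff_0 le_degree)
    moreover have "i \<le> degree (coeff p j)" using nz by (rule le_degree)
    ultimately show "i + j \<in> (\<Union>j\<le>degree p. (\<lambda>i. i + j) ` {..degree (coeff p j)})"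
      by blast
  qed
qed simp

definition map_degree :: "nat \<Rightarrow> (nat \<Rightarrow> complex poly poly) \<Rightarrow> nat" where
  "map_degree N P = Max (insert 0 ((\<lambda>k. total_degree (P k)) ` {..<N}))"

text \<open>
  Holomorphy in two variables on an open set: the real Frechet derivative exists at every
  point and is complex linear.
\<close>

definition holomorphic2_on :: "(complex \<times> complex \<Rightarrow> complex) \<Rightarrow> (complex \<times> complex) set \<Rightarrow> bool" where
  "holomorphic2_on f S \<longleftrightarrow>
     (\<forall>z\<in>S. \<exists>a b. (f has_derivative (\<lambda>h. a * fst h + b * snd h)) (at z))"

text \<open>
  The rational map \<open>P / g\<close> is holomorphic on \<open>S\<close> if it is represented there by holomorphic
  functions \<open>F k\<close>. The equation \<open>F k * g = P k\<close> is used in place of a pointwise quotient, so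
  that a possible zero of \<open>g\<close> is not treated by the convention \<open>x / 0 = 0\<close>.
\<close>

definition rational_holomorphic_on ::
  "nat \<Rightarrow> (nat \<Rightarrow> complex poly poly) \<Rightarrow> complex poly poly \<Rightarrow> (complex \<times> complex) set \<Rightarrow> bool" where
  "rational_holomorphic_on N P g S \<longleftrightarrow>
     g \<noteq> 0 \<and>
     (\<exists>F. \<forall>k<N. holomorphic2_on (F k) S \<and> (\<forall>z\<in>S. F k z * eval2 g z = eval2 (P k) z))"

definition sphere_map :: "nat \<Rightarrow> (nat \<Rightarrow> complex poly poly) \<Rightarrow> complex poly poly \<Rightarrow> bool" where
  "sphere_map N P g \<longleftrightarrow>
     rational_holomorphic_on N P g (ball 0 1) \<and>
     (\<forall>z\<in>sphere 0 1. (\<Sum>k<N. (cmod (eval2 (P k) z))\<^sup>2) = (cmod (eval2 g z))\<^sup>2)"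

definition reduced_fraction :: "nat \<Rightarrow> (nat \<Rightarrow> complex poly poly) \<Rightarrow> complex poly poly \<Rightarrow> bool" where
  "reduced_fraction N P g \<longleftrightarrow>
     (\<forall>d. d dvd g \<and> (\<forall>k<N. d dvd P k) \<longrightarrow> total_degree d = 0)"

end

theory Submission
  imports Defs
begin

text \<open>
  Write \<open>q = \<sigma>\<^sub>1 z\<^sub>1\<^sup>2 + \<sigma>\<^sub>2 z\<^sub>2\<^sup>2\<close>, so that \<open>g = 1 + q\<close>. If \<open>\<parallel>P\<parallel>\<^sup>2 = |g|\<^sup>2\<close> on the sphere, then as a
  polynomial in \<open>z\<close> and its conjugate \<open>\<parallel>P\<parallel>\<^sup>2 - |g|\<^sup>2\<close> is a multiple of \<open>\<parallel>z\<parallel>\<^sup>2 - 1\<close>. Averaging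
  \<open>\<parallel>P\<parallel>\<^sup>2\<close> over the sign changes of \<open>z\<^sub>1\<close> and \<open>z\<^sub>2\<close> keeps it a sum of squared moduli, and for
  cubic \<open>P\<close> with \<open>P 0 = 0\<close> the averages without quadratic monomials are the forms
  \<open>\<parallel>z\<parallel>\<^sup>2 |g|\<^sup>2 + (\<parallel>z\<parallel>\<^sup>4 - 1) (a\<^sub>1 |z\<^sub>1|\<^sup>2 + a\<^sub>2 |z\<^sub>2|\<^sup>2)\<close>
  with real \<open>a\<^sub>1\<close>, \<open>a\<^sub>2\<close>. Quadratic components only make positivity harder. So the question is for
  which \<open>\<sigma>\<close> such a form is a sum of squared moduli for a pair \<open>(a\<^sub>1, a\<^sub>2) \<noteq> (0, 0)\<close>; the pair
  \<open>(0, 0)\<close> belongs to \<open>P = g z\<close>, which is either not reduced or, for constant \<open>g\<close>, of degree 1.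

  The form splits into two Hermitian \<open>3 \<times> 3\<close> blocks, on \<open>z\<^sub>1, z\<^sub>1\<^sup>3, z\<^sub>1 z\<^sub>2\<^sup>2\<close> and on
  \<open>z\<^sub>2, z\<^sub>2\<^sup>3, z\<^sub>1\<^sup>2 z\<^sub>2\<close>. With \<open>v = (1, \<sigma>\<^sub>1, \<sigma>\<^sub>2)\<close> the first one is
  \<open>v v\<^sup>T + diag(-a\<^sub>1, a\<^sub>1, a\<^sub>1 + 2 a\<^sub>2)\<close>, and the second one arises by exchanging the indices. They
  force \<open>a\<^sub>1, a\<^sub>2 \<ge> 0\<close>, and for positive values a Schur complement turns positivity into
  \<open>a\<^sub>1 + \<sigma>\<^sub>1\<^sup>2 + \<sigma>\<^sub>2\<^sup>2 a\<^sub>1 / (a\<^sub>1 + 2 a\<^sub>2) \<le> 1\<close>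
  and its mirror image. With \<open>x = sqrt (1 - \<sigma>\<^sub>1\<^sup>2)\<close>, \<open>y = sqrt (1 - \<sigma>\<^sub>2\<^sup>2)\<close> and \<open>\<kappa> = 1 - x\<^sup>2 - y\<^sup>2\<close> these
  say, up to terms of second order in \<open>a\<close>, that \<open>\<kappa> a\<^sub>1 < 2 x\<^sup>2 a\<^sub>2\<close> and \<open>\<kappa> a\<^sub>2 < 2 y\<^sup>2 a\<^sub>1\<close>, which is
  solvable exactly if \<open>\<kappa> < 2 x y\<close>, that is \<open>x + y > 1\<close>.

  If \<open>x + y \<le> 1\<close>, then \<open>a\<^sub>1 = a\<^sub>2 = 0\<close>. The blocks now have rank one, and the relations among
  their rows carry over to the coefficient vectors of the map itself, averaged or not: every
  component is a linear form times \<open>g\<close> (\<open>cubic_sphere_map_rigidity\<close>). If \<open>x + y > 1\<close>, small positive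
  multiples of \<open>(x, y)\<close> make both blocks positive definite, and a Cholesky factorisation of the
  blocks (\<open>sector_sum_of_squares\<close>) is a reduced sphere map with six components
  (\<open>exists_reduced_cubic_sphere_map\<close>).
\<close>

section \<open>Polynomials in two variables\<close>

abbreviation mon :: "complex \<Rightarrow> nat \<Rightarrow> nat \<Rightarrow> complex poly poly" where
  "mon c i j \<equiv> monom (monom c i) j"

lemma eval2_mon: "eval2 (mon c i j) z = c * fst z ^ i * snd z ^ j"
  by (simp add: eval2_def poly_monom poly_power poly_mult)

lemma total_degree_leI:
  assumes "\<And>i j. coeff (coeff p j) i \<noteq> 0 \<Longrightarrow> i + j \<le> d"
  shows "total_degree p \<le> d"
  unfolding total_degree_def using assms finite_total_degree[of p] by auto

lemma le_total_degree:
  assumes "coeff (coeff p j) i \<noteq> 0"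
  shows "i + j \<le> total_degree p"
  unfolding total_degree_def using assms finite_total_degree[of p] by (auto intro!: Max_ge)

lemma quadratic_denominator_as_monomials:
  "1 + Const a * Z1 ^ 2 + Const b * Z2 ^ 2 = mon 1 0 0 + mon a 2 0 + mon b 0 2"
proof -
  have "Const a * Z1 ^ 2 = mon a 2 0"
    by (simp add: Const_def Z1_def power2_eq_square monom_altdef numeral_eq_Suc)
  moreover have "Const b * Z2 ^ 2 = mon b 0 2"
    by (simp add: Const_def Z2_def power2_eq_square monom_altdef numeral_eq_Suc)
  ultimately show ?thesis by (simp add: one_pCons monom_0)
qed

lemma poly_poly_as_sum_of_mon:
  assumes "total_degree p \<le> d"
  shows "p = (\<Sum>j\<le>d. \<Sum>i\<le>d. mon (coeff (coeff p j) i) i j)"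
proof -
  have "coeff p j = 0" if "j > d" for j
  proof (rule ccontr)
    assume "coeff p j \<noteq> 0"
    then have "coeff (coeff p j) (degree (coeff p j)) \<noteq> 0" by simp
    from le_total_degree[OF this] show False using assms that by simp
  qed
  then have 1: "degree p \<le> d" by (simp add: degree_le)
  have "degree (coeff p j) \<le> d" for j
    by (rule degree_le) (use le_total_degree[of p j] assms in fastforce)
  then have "(\<Sum>i\<le>d. monom (coeff (coeff p j) i) i) = coeff p j" for j
    by (rule poly_as_sum_of_monoms')
  moreover have "(\<Sum>j\<le>d. \<Sum>i\<le>d. mon (coeff (coeff p j) i) i j)
      = (\<Sum>j\<le>d. monom (\<Sum>i\<le>d. monom (coeff (coeff p j) i) i) j)"
    by (simp add: monom_sum)
  ultimately show ?thesis using poly_as_sum_of_monoms'[OF 1] by simp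
qed

lemma eval2_sum: "eval2 (\<Sum>i\<in>A. f i) z = (\<Sum>i\<in>A. eval2 (f i) z)"
  by (induction A rule: infinite_finite_induct) (simp_all add: eval2_simps)

lemma eval2_eq_sum:
  assumes "total_degree p \<le> d"
  shows "eval2 p z = (\<Sum>j\<le>d. \<Sum>i\<le>d. coeff (coeff p j) i * fst z ^ i * snd z ^ j)"
  by (subst poly_poly_as_sum_of_mon[OF assms]) (simp add: eval2_sum eval2_mon)

lemma eval2_hermitian_square:
  assumes "total_degree p \<le> d"
  shows "eval2 p z * cnj (eval2 p z)
    = (\<Sum>i\<le>d. \<Sum>k\<le>d. \<Sum>j\<le>d. \<Sum>l\<le>d. coeff (coeff p j) i * cnj (coeff (coeff p l) k)
        * (fst z ^ i * cnj (fst z) ^ k) * (snd z ^ j * cnj (snd z) ^ l))"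
proof -
  have "eval2 p z = (\<Sum>i\<le>d. \<Sum>j\<le>d. coeff (coeff p j) i * fst z ^ i * snd z ^ j)"
    by (subst eval2_eq_sum[OF assms], rule sum.swap)
  then show ?thesis by (simp add: sum_product ac_simps)
qed

text \<open>
  A divisor of a power of \<open>z\<^sub>1\<close> has outer degree 0, and its only coefficient divides the leading
  coefficient 1 of the power of \<open>z\<^sub>2\<close>.
\<close>

lemma total_degree_common_divisor_of_powers:
  assumes "d dvd mon 1 m 0" "d dvd mon 1 0 n"
  shows "total_degree d = 0"
proof -
  from assms(1) obtain e where e: "mon 1 m 0 = d * e" ..
  have "mon 1 m 0 \<noteq> 0" by (simp add: monom_eq_0_iff)
  then have "d \<noteq> 0" "e \<noteq> 0" using e by auto
  then have "degree d + degree e = degree (mon 1 m 0)" by (simp add: e degree_mult_eq)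
  also have "\<dots> = 0" by (simp add: degree_monom_eq monom_eq_0_iff)
  finally obtain q where q: "d = [:q:]" by (auto elim: degree_eq_zeroE)
  from assms(2) obtain e' where e': "mon 1 0 n = d * e'" ..
  have "coeff (mon 1 0 n) n = q * coeff e' n" unfolding e' q by simp
  then have "1 = q * coeff e' n" by (simp add: one_pCons monom_0)
  then have "is_unit q" by (rule dvdI)
  then obtain c where c: "q = [:c:]" by (auto simp: is_unit_poly_iff)
  have "total_degree d \<le> 0"
    by (rule total_degree_leI) (auto simp: q c coeff_pCons split: nat.splits)
  then show ?thesis by simp
qed


section \<open>Fourier coefficients of Hermitian polynomials on the torus\<close>

lemma infinite_unit_circle: "infinite {w::complex. cmod w = 1}"
proof -
  have "x \<in> Re ` {w. cmod w = 1}" if "x \<in> {0..1}" for x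
    by (rule image_eqI[of _ _ "Complex x (sqrt (1 - x\<^sup>2))"])
      (use that in \<open>auto simp: cmod_def abs_square_le_1 power_le_one\<close>)
  then have "{0..1} \<subseteq> Re ` {w. cmod w = 1}" by blast
  moreover have "infinite {0..1::real}" by (rule infinite_Icc) simp
  ultimately show ?thesis using finite_subset by blast
qed

text \<open>
  Multiplying by \<open>w ^ d\<close> turns a trigonometric polynomial into an ordinary one, because the
  conjugate of \<open>w\<close> is \<open>1 / w\<close> on the circle; an ordinary polynomial with infinitely many zeros
  vanishes. The index \<open>m\<close> is the frequency \<open>i - k\<close> shifted by \<open>d\<close>, which keeps it a natural number.
\<close>

lemma unit_circle_coeffs_zero:
  assumes "\<And>w. cmod w = 1 \<Longrightarrow> (\<Sum>i\<le>d. \<Sum>k\<le>d. c i k * (w ^ i * cnj w ^ k)) = 0"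
  shows "(\<Sum>i\<le>d. \<Sum>k\<le>d. if i + d = k + m then c i k else 0) = 0"
proof -
  define p where "p = (\<Sum>i\<le>d. \<Sum>k\<le>d. monom (c i k) (i + d - k))"
  have root: "poly p w = 0" if w: "cmod w = 1" for w
  proof -
    have "w ^ d * cnj w ^ k = w ^ (d - k)" if "k \<le> d" for k
    proof -
      have "w * cnj w = 1" using w by (simp add: complex_norm_square[symmetric])
      then have "w ^ k * cnj w ^ k = 1" by (simp flip: power_mult_distrib)
      moreover have "w ^ d = w ^ (d - k) * w ^ k" using that by (simp flip: power_add)
      ultimately show ?thesis by (simp add: mult.assoc)
    qed
    then have "w ^ d * (w ^ i * cnj w ^ k) = w ^ (i + d - k)" if "k \<le> d" for i k
      using that by (simp add: mult.left_commute[of "w ^ d"] flip: power_add)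
    then have "poly p w = w ^ d * (\<Sum>i\<le>d. \<Sum>k\<le>d. c i k * (w ^ i * cnj w ^ k))"
      unfolding p_def
      by (simp add: poly_sum poly_monom sum_distrib_left mult.left_commute[of "w ^ d"])
    then show ?thesis using assms[OF w] by simp
  qed
  have "p = 0"
  proof (rule ccontr)
    assume "p \<noteq> 0"
    then have "finite {w. poly p w = 0}" by (rule poly_roots_finite)
    moreover have "{w. cmod w = 1} \<subseteq> {w. poly p w = 0}" using root by blast
    ultimately show False using infinite_unit_circle finite_subset by blast
  qed
  then have "0 = coeff p m" by simp
  also have "\<dots> = (\<Sum>i\<le>d. \<Sum>k\<le>d. if i + d - k = m then c i k else 0)"
    unfolding p_def by (simp add: coeff_sum)
  also have "\<dots> = (\<Sum>i\<le>d. \<Sum>k\<le>d. if i + d = k + m then c i k else 0)"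
    by (intro sum.cong refl) auto
  finally show ?thesis by simp
qed

lemma torus_coeffs_zero:
  assumes "\<And>w v. cmod w = 1 \<Longrightarrow> cmod v = 1 \<Longrightarrow>
    (\<Sum>i\<le>d. \<Sum>k\<le>d. \<Sum>j\<le>d. \<Sum>l\<le>d. C i j k l * (w ^ i * cnj w ^ k) * (v ^ j * cnj v ^ l)) = 0"
  shows "(\<Sum>j\<le>d. \<Sum>l\<le>d. if j + d = l + n
      then (\<Sum>i\<le>d. \<Sum>k\<le>d. if i + d = k + m then C i j k l else 0) else 0) = 0"
proof (rule unit_circle_coeffs_zero)
  fix v :: complex assume v: "cmod v = 1"
  have "(\<Sum>i\<le>d. \<Sum>k\<le>d. if i + d = k + m
      then (\<Sum>j\<le>d. \<Sum>l\<le>d. C i j k l * (v ^ j * cnj v ^ l)) else 0) = 0"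
    by (rule unit_circle_coeffs_zero)
      (use assms[OF _ v] in \<open>simp add: sum_distrib_left sum_distrib_right ac_simps\<close>)
  also have "(\<Sum>i\<le>d. \<Sum>k\<le>d. if i + d = k + m
      then (\<Sum>j\<le>d. \<Sum>l\<le>d. C i j k l * (v ^ j * cnj v ^ l)) else 0)
    = (\<Sum>i\<le>d. \<Sum>k\<le>d. \<Sum>j\<le>d. \<Sum>l\<le>d.
        (if i + d = k + m then C i j k l else 0) * (v ^ j * cnj v ^ l))"
    by (intro sum.cong refl) auto
  also have "\<dots> = (\<Sum>i\<le>d. \<Sum>j\<le>d. \<Sum>k\<le>d. \<Sum>l\<le>d.
        (if i + d = k + m then C i j k l else 0) * (v ^ j * cnj v ^ l))"
    by (intro sum.cong refl sum.swap)
  also have "\<dots> = (\<Sum>j\<le>d. \<Sum>i\<le>d. \<Sum>k\<le>d. \<Sum>l\<le>d.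
        (if i + d = k + m then C i j k l else 0) * (v ^ j * cnj v ^ l))"
    by (rule sum.swap)
  also have "\<dots> = (\<Sum>j\<le>d. \<Sum>i\<le>d. \<Sum>l\<le>d. \<Sum>k\<le>d.
        (if i + d = k + m then C i j k l else 0) * (v ^ j * cnj v ^ l))"
    by (intro sum.cong refl sum.swap)
  also have "\<dots> = (\<Sum>j\<le>d. \<Sum>l\<le>d. \<Sum>i\<le>d. \<Sum>k\<le>d.
        (if i + d = k + m then C i j k l else 0) * (v ^ j * cnj v ^ l))"
    by (intro sum.cong refl sum.swap)
  finally show "(\<Sum>j\<le>d. \<Sum>l\<le>d. (\<Sum>i\<le>d. \<Sum>k\<le>d. if i + d = k + m then C i j k l else 0)
      * (v ^ j * cnj v ^ l)) = 0"
    by (simp add: sum_distrib_right)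
qed

text \<open>
  The sphere is the union of the tori \<open>|z\<^sub>1|\<^sup>2 = S\<close>, \<open>|z\<^sub>2|\<^sup>2 = T\<close> with \<open>S + T = 1\<close>, and on each
  of them the Fourier coefficients of \<open>\<parallel>P\<parallel>\<^sup>2 - |g|\<^sup>2\<close> have to vanish separately. This replaces
  division by \<open>\<parallel>z\<parallel>\<^sup>2 - 1\<close> and averaging over symmetries.
\<close>

lemma sphere_identity_coeffs:
  fixes P :: "nat \<Rightarrow> complex poly poly" and S T :: real
  assumes "\<And>k. k < N \<Longrightarrow> total_degree (P k) \<le> d" "total_degree g \<le> d"
    and "\<forall>z\<in>sphere 0 1. (\<Sum>k<N. (cmod (eval2 (P k) z))\<^sup>2) = (cmod (eval2 g z))\<^sup>2"
    and "S \<ge> 0" "T \<ge> 0" "S + T = 1"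
    and H: "\<And>i j k l. H i j k l =
      (\<Sum>n<N. coeff (coeff (P n) j) i * cnj (coeff (coeff (P n) l) k))
        - coeff (coeff g j) i * cnj (coeff (coeff g l) k)"
  shows "(\<Sum>j\<le>d. \<Sum>l\<le>d. if j + d = l + n then (\<Sum>i\<le>d. \<Sum>k\<le>d. if i + d = k + m
     then H i j k l * complex_of_real (sqrt S ^ (i + k) * sqrt T ^ (j + l)) else 0) else 0) = 0"
proof (rule torus_coeffs_zero)
  fix w v :: complex assume w: "cmod w = 1" and v: "cmod v = 1"
  define z where "z = (sqrt S * w, sqrt T * v)"
  have "(norm z)\<^sup>2 = 1"
    using assms(4-6) w v by (simp add: z_def norm_Pair norm_mult)
  then have "z \<in> sphere 0 1" by (simp add: power2_eq_1_iff) (smt (verit) norm_ge_zero)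
  then have "(\<Sum>n<N. (cmod (eval2 (P n) z))\<^sup>2) = (cmod (eval2 g z))\<^sup>2" using assms(3) by blast
  then have "complex_of_real (\<Sum>n<N. (cmod (eval2 (P n) z))\<^sup>2) = complex_of_real ((cmod (eval2 g z))\<^sup>2)"
    by (rule arg_cong)
  then have "(\<Sum>n<N. eval2 (P n) z * cnj (eval2 (P n) z)) - eval2 g z * cnj (eval2 g z) = 0"
    by (simp add: complex_norm_square del: of_real_power)
  moreover have "(\<Sum>n<N. eval2 (P n) z * cnj (eval2 (P n) z))
    = (\<Sum>n<N. \<Sum>i\<le>d. \<Sum>k\<le>d. \<Sum>j\<le>d. \<Sum>l\<le>d. coeff (coeff (P n) j) i * cnj (coeff (coeff (P n) l) k)
        * (fst z ^ i * cnj (fst z) ^ k) * (snd z ^ j * cnj (snd z) ^ l))"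
    using assms(1) by (intro sum.cong refl eval2_hermitian_square) simp
  moreover have "\<dots>
    = (\<Sum>i\<le>d. \<Sum>k\<le>d. \<Sum>j\<le>d. \<Sum>l\<le>d. \<Sum>n<N. coeff (coeff (P n) j) i * cnj (coeff (coeff (P n) l) k)
        * (fst z ^ i * cnj (fst z) ^ k) * (snd z ^ j * cnj (snd z) ^ l))"
    by (simp only: sum.swap[of _ "{..d}" "{..<N}"])
  moreover have "(\<Sum>i\<le>d. \<Sum>k\<le>d. \<Sum>j\<le>d. \<Sum>l\<le>d.
      H i j k l * (fst z ^ i * cnj (fst z) ^ k) * (snd z ^ j * cnj (snd z) ^ l))
    = (\<Sum>i\<le>d. \<Sum>k\<le>d. \<Sum>j\<le>d. \<Sum>l\<le>d. \<Sum>n<N. coeff (coeff (P n) j) i * cnj (coeff (coeff (P n) l) k)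
        * (fst z ^ i * cnj (fst z) ^ k) * (snd z ^ j * cnj (snd z) ^ l))
      - eval2 g z * cnj (eval2 g z)"
    unfolding eval2_hermitian_square[OF assms(2)]
    by (simp only: H sum_subtractf sum_distrib_right left_diff_distrib)
  ultimately have "(\<Sum>i\<le>d. \<Sum>k\<le>d. \<Sum>j\<le>d. \<Sum>l\<le>d.
      H i j k l * (fst z ^ i * cnj (fst z) ^ k) * (snd z ^ j * cnj (snd z) ^ l)) = 0"
    by argo
  moreover have "H i j k l * (fst z ^ i * cnj (fst z) ^ k) * (snd z ^ j * cnj (snd z) ^ l)
      = H i j k l * complex_of_real (sqrt S ^ (i + k) * sqrt T ^ (j + l))
        * (w ^ i * cnj w ^ k) * (v ^ j * cnj v ^ l)" for i j k l
    by (simp add: z_def power_mult_distrib power_add)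
  ultimately show "(\<Sum>i\<le>d. \<Sum>k\<le>d. \<Sum>j\<le>d. \<Sum>l\<le>d.
      H i j k l * complex_of_real (sqrt S ^ (i + k) * sqrt T ^ (j + l))
        * (w ^ i * cnj w ^ k) * (v ^ j * cnj v ^ l)) = 0"
    by (simp only:)
qed


section \<open>Gram matrices of the coefficient vectors\<close>

text \<open>
  The real part of the Hermitian inner product on \<open>\<complex>\<^sup>N\<close>. All test vectors below have real
  coefficients, so only the real part of a Gram matrix is ever evaluated.
\<close>

definition dot :: "nat \<Rightarrow> (nat \<Rightarrow> complex) \<Rightarrow> (nat \<Rightarrow> complex) \<Rightarrow> real" where
  "dot N x y = (\<Sum>n<N. Re (x n * cnj (y n)))"

lemma dot_commute: "dot N x y = dot N y x"
  by (simp add: dot_def mult.commute)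

lemma dot_self: "dot N x x = (\<Sum>n<N. (cmod (x n))\<^sup>2)"
  unfolding dot_def by (simp add: complex_norm_square[symmetric] del: of_real_power)

lemma dot_self_nonneg: "dot N x x \<ge> 0"
  by (simp add: dot_self sum_nonneg)

lemma dot_self_eq_0: "dot N x x = 0 \<Longrightarrow> n < N \<Longrightarrow> x n = 0"
  by (simp add: dot_self sum_nonneg_eq_0_iff)

lemma dot_combination:
  fixes a b c :: real and x y z :: "nat \<Rightarrow> complex"
  shows "dot N (\<lambda>n. a * x n + b * y n + c * z n) (\<lambda>n. a * x n + b * y n + c * z n)
    = a\<^sup>2 * dot N x x + b\<^sup>2 * dot N y y + c\<^sup>2 * dot N z z
      + 2 * a * b * dot N y x + 2 * a * c * dot N z x + 2 * b * c * dot N y z"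
  unfolding dot_def sum_distrib_left sum.distrib[symmetric]
  by (intro sum.cong refl) (simp add: power2_eq_square algebra_simps)

text \<open>
  Of all Fourier coefficients on the tori only the frequencies \<open>(0, 0)\<close>, \<open>(2, 0)\<close>, \<open>(0, 2)\<close> and
  \<open>(2, -2)\<close> matter: they are the frequencies of \<open>|g|\<^sup>2\<close> up to conjugation, and they determine the two
  \<open>3 \<times> 3\<close> Gram blocks up to the norms of the linear coefficients and the quadratic part of the map.
\<close>

lemma cubic_sphere_relations:
  fixes P :: "nat \<Rightarrow> complex poly poly" and \<sigma>1 \<sigma>2 :: real
  assumes g_def: "g = mon 1 0 0 + mon (complex_of_real \<sigma>1) 2 0 + mon (complex_of_real \<sigma>2) 0 2"
    and p_def: "p = (\<lambda>i j n. coeff (coeff (P n) j) i)"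
    and deg_all: "\<forall>k<N. total_degree (P k) \<le> 3"
    and p00_all: "\<forall>k<N. p 0 0 k = 0"
    and sphere: "\<forall>z\<in>sphere 0 1. (\<Sum>k<N. (cmod (eval2 (P k) z))\<^sup>2) = (cmod (eval2 g z))\<^sup>2"
  shows "dot N (p 3 0) (p 1 0) = \<sigma>1" "dot N (p 2 1) (p 0 1) = \<sigma>1"
    and "dot N (p 1 2) (p 1 0) = \<sigma>2" "dot N (p 0 3) (p 0 1) = \<sigma>2"
    and "dot N (p 3 0) (p 1 2) = \<sigma>1 * \<sigma>2 - dot N (p 2 0) (p 0 2)"
    and "dot N (p 2 1) (p 0 3) = \<sigma>1 * \<sigma>2 - dot N (p 2 0) (p 0 2)"
    and "dot N (p 1 0) (p 1 0) + dot N (p 2 0) (p 2 0) + dot N (p 3 0) (p 3 0) = 1 + \<sigma>1\<^sup>2"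
    and "dot N (p 0 1) (p 0 1) + dot N (p 0 2) (p 0 2) + dot N (p 0 3) (p 0 3) = 1 + \<sigma>2\<^sup>2"
    and "2 * dot N (p 1 0) (p 1 0) + dot N (p 0 1) (p 0 1) + dot N (p 1 1) (p 1 1)
      + dot N (p 2 0) (p 2 0) + dot N (p 2 1) (p 2 1) = 3 + \<sigma>1\<^sup>2"
    and "dot N (p 1 0) (p 1 0) + 2 * dot N (p 0 1) (p 0 1) + dot N (p 1 1) (p 1 1)
      + dot N (p 0 2) (p 0 2) + dot N (p 1 2) (p 1 2) = 3 + \<sigma>2\<^sup>2"
proof -
  note deg = deg_all[rule_format] and p00 = p00_all[rule_format]
  define q where "q = (\<lambda>i j. coeff (coeff g j) i)"
  have q: "q i j = (if i = 0 \<and> j = 0 then 1 else if i = 2 \<and> j = 0 then \<sigma>1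
      else if i = 0 \<and> j = 2 then \<sigma>2 else 0)" for i j
    by (auto simp: q_def g_def)
  have gdeg: "total_degree g \<le> 3"
    by (rule total_degree_leI) (use q in \<open>auto simp: q_def split: if_splits\<close>)
  define H where "H = (\<lambda>i j k l. (\<Sum>n<N. p i j n * cnj (p k l n)) - q i j * cnj (q k l))"
  have high: "p i j n = 0" if "n < N" "i + j > 3" for i j n
    using le_total_degree[of "P n" j i] deg[OF that(1)] that(2) unfolding p_def by fastforce
  have ReH: "Re (H i j k l) = dot N (p i j) (p k l) - Re (q i j * cnj (q k l))" for i j k l
    by (simp add: H_def dot_def)
  have zero: "H i j k l = 0" if "i + j > 3 \<or> k + l > 3" for i j k l
    using that unfolding H_def by (auto simp: q high p00)
  have [simp]: "dot N (p 0 0) (p i j) = 0" "dot N (p i j) (p 0 0) = 0" for i j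
    by (simp_all add: dot_def p00)
  have [simp]: "dot N (p i j) y = 0" "dot N y (p i j) = 0" if "i + j > 3" for i j y
    using that by (simp_all add: dot_def high)
  have four: "{..3} = {0, 1, 2, 3::nat}" by auto
  {
    fix S T :: real assume ST: "S \<ge> 0" "T \<ge> 0" "S + T = 1"
    have pw: "sqrt S ^ 2 = S" "sqrt S ^ 4 = S ^ 2" "sqrt S ^ 6 = S ^ 3"
      "sqrt T ^ 2 = T" "sqrt T ^ 4 = T ^ 2" "sqrt T ^ 6 = T ^ 3"
      using ST power_mult[of "sqrt S" 2 2] power_mult[of "sqrt S" 2 3]
        power_mult[of "sqrt T" 2 2] power_mult[of "sqrt T" 2 3] by auto
    have eq: "(\<Sum>j\<le>3. \<Sum>l\<le>3. if j + 3 = l + n then (\<Sum>i\<le>3. \<Sum>k\<le>3. if i + 3 = k + m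
     then Re (H i j k l) * (sqrt S ^ (i + k) * sqrt T ^ (j + l)) else 0) else 0) = 0" for m n
    proof -
      have "Re (\<Sum>j\<le>3. \<Sum>l\<le>3. if j + 3 = l + n then (\<Sum>i\<le>3. \<Sum>k\<le>3. if i + 3 = k + m
     then H i j k l * complex_of_real (sqrt S ^ (i + k) * sqrt T ^ (j + l)) else 0) else 0) = 0"
        by (subst sphere_identity_coeffs[OF deg gdeg sphere ST])
           (simp_all add: H_def p_def q_def)
      then show ?thesis by (simp add: if_distrib[of Re] cong: if_cong)
    qed
    \<comment> \<open>Indices are shifted by 3, so \<open>m = 5\<close>, \<open>n = 1\<close> is the frequency \<open>(2, -2)\<close>.\<close>
    note simps = four zero ReH pw q numeral_2_eq_2[symmetric] numeral_3_eq_3[symmetric]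
    have E1: "dot N (p 1 0) (p 1 0) * S + dot N (p 0 1) (p 0 1) * T + dot N (p 2 0) (p 2 0) * S\<^sup>2
      + dot N (p 1 1) (p 1 1) * S * T + dot N (p 0 2) (p 0 2) * T\<^sup>2 + dot N (p 3 0) (p 3 0) * S ^ 3
      + dot N (p 2 1) (p 2 1) * S\<^sup>2 * T + dot N (p 1 2) (p 1 2) * S * T\<^sup>2
      + dot N (p 0 3) (p 0 3) * T ^ 3 = 1 + \<sigma>1\<^sup>2 * S\<^sup>2 + \<sigma>2\<^sup>2 * T\<^sup>2"
      using eq[where m = 3 and n = 3] ST by (simp add: simps power2_eq_square[of \<sigma>1] power2_eq_square[of \<sigma>2] algebra_simps)
    have E2: "dot N (p 3 0) (p 1 0) * S\<^sup>2 + dot N (p 2 1) (p 0 1) * S * T = \<sigma>1 * S"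
      using eq[where m = 5 and n = 3] ST by (simp add: simps algebra_simps)
    have E3: "dot N (p 1 2) (p 1 0) * S * T + dot N (p 0 3) (p 0 1) * T\<^sup>2 = \<sigma>2 * T"
      using eq[where m = 3 and n = 5] ST by (simp add: simps algebra_simps)
    have E4: "dot N (p 2 0) (p 0 2) * S * T + dot N (p 3 0) (p 1 2) * S\<^sup>2 * T
      + dot N (p 2 1) (p 0 3) * S * T\<^sup>2 = \<sigma>1 * \<sigma>2 * S * T"
      using eq[where m = 5 and n = 1] ST by (simp add: simps algebra_simps)
    note E1 E2 E3 E4
  } note E = this

  \<comment> \<open>On \<open>S + T = 1\<close> the relations are cubic polynomials in \<open>S\<close>, so four points determine all
    of their coefficients.\<close>
  note One_nat_def [simp del]
  note E' = E[of 1 0, simplified] E[of 0 1, simplified]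
    E[of "1/2" "1/2", simplified power2_eq_square power3_eq_cube, simplified]
    E[of "1/3" "2/3", simplified power2_eq_square power3_eq_cube, simplified]
  show "dot N (p 3 0) (p 1 0) = \<sigma>1" "dot N (p 2 1) (p 0 1) = \<sigma>1"
    "dot N (p 1 2) (p 1 0) = \<sigma>2" "dot N (p 0 3) (p 0 1) = \<sigma>2"
    using E' by - linarith+
  show "dot N (p 3 0) (p 1 2) = \<sigma>1 * \<sigma>2 - dot N (p 2 0) (p 0 2)"
    "dot N (p 2 1) (p 0 3) = \<sigma>1 * \<sigma>2 - dot N (p 2 0) (p 0 2)"
    using E' by - linarith+
  show "dot N (p 1 0) (p 1 0) + dot N (p 2 0) (p 2 0) + dot N (p 3 0) (p 3 0) = 1 + \<sigma>1\<^sup>2"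
    "dot N (p 0 1) (p 0 1) + dot N (p 0 2) (p 0 2) + dot N (p 0 3) (p 0 3) = 1 + \<sigma>2\<^sup>2"
    using E' by - linarith+
  show "2 * dot N (p 1 0) (p 1 0) + dot N (p 0 1) (p 0 1) + dot N (p 1 1) (p 1 1)
      + dot N (p 2 0) (p 2 0) + dot N (p 2 1) (p 2 1) = 3 + \<sigma>1\<^sup>2"
    "dot N (p 1 0) (p 1 0) + 2 * dot N (p 0 1) (p 0 1) + dot N (p 1 1) (p 1 1)
      + dot N (p 0 2) (p 0 2) + dot N (p 1 2) (p 1 2) = 3 + \<sigma>2\<^sup>2"
    using E' unfolding power2_eq_square power3_eq_cube by - linarith+
qed

section \<open>Positivity of a block\<close>

text \<open>
  The form has the matrix \<open>v v\<^sup>T + diag(-a, a, e)\<close> with \<open>v = (1, s, t)\<close>. The inequality is the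
  Schur complement condition for the first variable; it is obtained from the single test vector at
  which the form is minimal for a given \<open>c0\<close>, scaled so that the linear form \<open>c0 + s c1 + t c2\<close>
  takes the value 1.
\<close>

lemma sector_inequality:
  fixes a e s t :: real
  assumes form: "\<And>c0 c1 c2. 0 \<le> (c0 + s * c1 + t * c2)\<^sup>2 - a * c0\<^sup>2 + a * c1\<^sup>2 + e * c2\<^sup>2"
    and "a > 0" "e > 0"
  shows "e * (a + s\<^sup>2) + a * t\<^sup>2 \<le> e"
proof -
  define m where "m = s\<^sup>2 / a + t\<^sup>2 / e"
  have m: "m \<ge> 0" unfolding m_def using assms by simp
  have am: "a * (s / a)\<^sup>2 + e * (t / e)\<^sup>2 = m"
    using assms by (simp add: m_def power2_eq_square)
  have v: "(1 + m) + s * - (s / a) + t * - (t / e) = 1"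
    by (simp add: m_def power2_eq_square)
  have "0 \<le> 1 - a * (1 + m)\<^sup>2 + m"
    using form[of "1 + m" "- (s / a)" "- (t / e)"] am unfolding v power2_minus by simp
  also have "\<dots> = (1 + m) * (1 - a * (1 + m))" by (simp add: power2_eq_square algebra_simps)
  finally have "a * (1 + m) \<le> 1" using m by (simp add: zero_le_mult_iff)
  then have "e * (a * (1 + m)) \<le> e" using assms by simp
  moreover have "e * (a * (1 + m)) = e * (a + s\<^sup>2) + a * t\<^sup>2"
    using assms by (simp add: m_def field_simps)
  ultimately show ?thesis by simp
qed

text \<open>
  The two hypotheses on the blocks amount to \<open>\<kappa> a1 < 2 x\<^sup>2 a2\<close> and \<open>\<kappa> a2 < 2 y\<^sup>2 a1\<close>, where now
  \<open>\<kappa> \<ge> 2 x y > 0\<close>. The first one rules out \<open>a2 = 0 < a1\<close>, the second one \<open>a1 = 0 < a2\<close>, and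
  their product rules out two positive values.
\<close>

lemma sqrt_sum_le_1_imp:
  fixes a1 a2 \<sigma>1 \<sigma>2 :: real
  assumes "0 \<le> \<sigma>1" "\<sigma>1 < 1" "0 \<le> \<sigma>2" "\<sigma>2 < 1" "a1 \<ge> 0" "a2 \<ge> 0"
    and le: "sqrt (1 - \<sigma>1 ^ 2) + sqrt (1 - \<sigma>2 ^ 2) \<le> 1"
    and 1: "a1 > 0 \<Longrightarrow> (a1 + 2 * a2) * (a1 + \<sigma>1\<^sup>2) + a1 * \<sigma>2\<^sup>2 \<le> a1 + 2 * a2"
    and 2: "a2 > 0 \<Longrightarrow> (a2 + 2 * a1) * (a2 + \<sigma>2\<^sup>2) + a2 * \<sigma>1\<^sup>2 \<le> a2 + 2 * a1"
  shows "a1 = 0 \<and> a2 = 0"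
proof (rule ccontr)
  define x y where "x = sqrt (1 - \<sigma>1 ^ 2)" and "y = sqrt (1 - \<sigma>2 ^ 2)"
  have "\<sigma>1\<^sup>2 < 1" "\<sigma>2\<^sup>2 < 1" using assms by (simp_all add: abs_square_less_1)
  then have pos: "x > 0" "y > 0" and sq: "\<sigma>1\<^sup>2 = 1 - x\<^sup>2" "\<sigma>2\<^sup>2 = 1 - y\<^sup>2"
    by (simp_all add: x_def y_def)
  define \<kappa> where "\<kappa> = 1 - x\<^sup>2 - y\<^sup>2"
  have "(x + y)\<^sup>2 \<le> 1" using le pos by (simp add: x_def y_def power_le_one)
  then have \<kappa>: "2 * x * y \<le> \<kappa>" by (simp add: \<kappa>_def power2_sum)
  then have \<kappa>0: "\<kappa> > 0" using mult_pos_pos[OF pos] by linarith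
  assume neg: "\<not> (a1 = 0 \<and> a2 = 0)"
  have b1: "\<kappa> * a1 < 2 * x\<^sup>2 * a2" if "a1 > 0"
  proof -
    have "\<kappa> * a1 + (a1\<^sup>2 + 2 * a1 * a2) \<le> 2 * x\<^sup>2 * a2"
      using 1[OF that] unfolding sq \<kappa>_def by (simp add: power2_eq_square algebra_simps)
    moreover have "a1\<^sup>2 + 2 * a1 * a2 > 0" using that assms by (simp add: add_pos_nonneg)
    ultimately show ?thesis by linarith
  qed
  have b2: "\<kappa> * a2 < 2 * y\<^sup>2 * a1" if "a2 > 0"
  proof -
    have "\<kappa> * a2 + (a2\<^sup>2 + 2 * a2 * a1) \<le> 2 * y\<^sup>2 * a1"
      using 2[OF that] unfolding sq \<kappa>_def by (simp add: power2_eq_square algebra_simps)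
    moreover have "a2\<^sup>2 + 2 * a2 * a1 > 0" using that assms by (simp add: add_pos_nonneg)
    ultimately show ?thesis by linarith
  qed
  have "a2 \<noteq> 0" if "a1 > 0" using b1[OF that] mult_pos_pos[OF \<kappa>0 that] by auto
  moreover have "a1 \<noteq> 0" if "a2 > 0" using b2[OF that] mult_pos_pos[OF \<kappa>0 that] by auto
  ultimately have "a1 > 0 \<and> a2 > 0" using neg assms(5,6) by linarith
  then have "(\<kappa> * a1) * (\<kappa> * a2) < (2 * x\<^sup>2 * a2) * (2 * y\<^sup>2 * a1)"
    using b1 b2 \<kappa>0 pos by (intro mult_strict_mono[OF b1 b2]) auto
  then have "\<kappa>\<^sup>2 * (a1 * a2) < (2 * x * y)\<^sup>2 * (a1 * a2)" by (simp add: power2_eq_square ac_simps)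
  then have "\<kappa>\<^sup>2 < (2 * x * y)\<^sup>2" using \<open>a1 > 0 \<and> a2 > 0\<close> by simp
  moreover have "(2 * x * y)\<^sup>2 \<le> \<kappa>\<^sup>2" using \<kappa> pos by (intro power_mono) auto
  ultimately show False by simp
qed


section \<open>Rigidity below the threshold\<close>

text \<open>
  The quadratic form of each block is a sum of squared norms: one of a combination of odd
  coefficient vectors, one of a combination of quadratic ones, and a multiple of that of \<open>z\<^sub>1 z\<^sub>2\<close>.
  Once \<open>a1 = a2 = 0\<close> the form degenerates to the square of \<open>c0 + \<sigma>1 c1 + \<sigma>2 c2\<close>, so on its
  kernel every one of these terms is 0, which yields the coefficients of a linear form times \<open>g\<close>.
\<close>

lemma cubic_sphere_map_rigidity:
  fixes P :: "nat \<Rightarrow> complex poly poly" and \<sigma>1 \<sigma>2 :: real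
  assumes g_def: "g = mon 1 0 0 + mon (complex_of_real \<sigma>1) 2 0 + mon (complex_of_real \<sigma>2) 0 2"
    and p_def: "p = (\<lambda>i j n. coeff (coeff (P n) j) i)"
    and deg_all: "\<forall>k<N. total_degree (P k) \<le> 3"
    and p00_all: "\<forall>k<N. p 0 0 k = 0"
    and sphere: "\<forall>z\<in>sphere 0 1. (\<Sum>k<N. (cmod (eval2 (P k) z))\<^sup>2) = (cmod (eval2 g z))\<^sup>2"
    and \<sigma>: "0 \<le> \<sigma>1" "\<sigma>1 < 1" "0 \<le> \<sigma>2" "\<sigma>2 < 1"
    and le: "sqrt (1 - \<sigma>1 ^ 2) + sqrt (1 - \<sigma>2 ^ 2) \<le> 1"
    and n: "n < N"
  shows "P n = (mon (p 1 0 n) 1 0 + mon (p 0 1 n) 0 1) * g"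
proof -
  note deg = deg_all[rule_format] and p00 = p00_all[rule_format]
  note R = cubic_sphere_relations[OF g_def p_def deg_all p00_all sphere]
  define a1 where "a1 = 1 - dot N (p 1 0) (p 1 0)"
  define a2 where "a2 = 1 - dot N (p 0 1) (p 0 1)"
  \<comment> \<open>The vanishing first term of \<open>even\<close> gives it the three-term shape of \<open>dot_combination\<close>.\<close>
  define odd1 where "odd1 = (\<lambda>(c0 :: real) (c1 :: real) (c2 :: real) n. c0 * p 1 0 n + c1 * p 3 0 n + c2 * p 1 2 n)"
  define odd2 where "odd2 = (\<lambda>(c0 :: real) (c1 :: real) (c2 :: real) n. c0 * p 0 1 n + c1 * p 0 3 n + c2 * p 2 1 n)"
  define even where "even = (\<lambda>(c1 :: real) (c2 :: real) n. complex_of_real 0 * p 0 0 n + c1 * p 2 0 n + c2 * p 0 2 n)"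
  have norms: "dot N (p 1 0) (p 1 0) = 1 - a1" "dot N (p 0 1) (p 0 1) = 1 - a2"
    "dot N (p 3 0) (p 3 0) = \<sigma>1\<^sup>2 + a1 - dot N (p 2 0) (p 2 0)"
    "dot N (p 0 3) (p 0 3) = \<sigma>2\<^sup>2 + a2 - dot N (p 0 2) (p 0 2)"
    "dot N (p 2 1) (p 2 1) = \<sigma>1\<^sup>2 + (a2 + 2 * a1) - dot N (p 2 0) (p 2 0) - dot N (p 1 1) (p 1 1)"
    "dot N (p 1 2) (p 1 2) = \<sigma>2\<^sup>2 + (a1 + 2 * a2) - dot N (p 0 2) (p 0 2) - dot N (p 1 1) (p 1 1)"
    using R(7-10) unfolding a1_def a2_def by (simp_all add: algebra_simps del: One_nat_def)
  have Q1: "dot N (odd1 c0 c1 c2) (odd1 c0 c1 c2) + dot N (even c1 c2) (even c1 c2)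
      + c2\<^sup>2 * dot N (p 1 1) (p 1 1)
      = (c0 + \<sigma>1 * c1 + \<sigma>2 * c2)\<^sup>2 - a1 * c0\<^sup>2 + a1 * c1\<^sup>2 + (a1 + 2 * a2) * c2\<^sup>2" for c0 c1 c2
    unfolding odd1_def even_def dot_combination norms R(1-6)
    by (simp add: power2_eq_square algebra_simps)
  have Q2: "dot N (odd2 c0 c1 c2) (odd2 c0 c1 c2) + dot N (even c2 c1) (even c2 c1)
      + c2\<^sup>2 * dot N (p 1 1) (p 1 1)
      = (c0 + \<sigma>2 * c1 + \<sigma>1 * c2)\<^sup>2 - a2 * c0\<^sup>2 + a2 * c1\<^sup>2 + (a2 + 2 * a1) * c2\<^sup>2" for c0 c1 c2
    unfolding odd2_def even_def dot_combination norms R(1-6) dot_commute[of N "p 0 3" "p 2 1"]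
    by (simp add: power2_eq_square algebra_simps)
  have F1: "0 \<le> (c0 + \<sigma>1 * c1 + \<sigma>2 * c2)\<^sup>2 - a1 * c0\<^sup>2 + a1 * c1\<^sup>2 + (a1 + 2 * a2) * c2\<^sup>2" for c0 c1 c2
    unfolding Q1[symmetric] by (simp add: dot_self_nonneg)
  have F2: "0 \<le> (c0 + \<sigma>2 * c1 + \<sigma>1 * c2)\<^sup>2 - a2 * c0\<^sup>2 + a2 * c1\<^sup>2 + (a2 + 2 * a1) * c2\<^sup>2" for c0 c1 c2
    unfolding Q2[symmetric] by (simp add: dot_self_nonneg)
  \<comment> \<open>The vector \<open>(-\<sigma>1, 1, 0)\<close> lies in the kernel of \<open>c0 + \<sigma>1 c1 + \<sigma>2 c2\<close>, so the form takes
    the value \<open>a1 (1 - \<sigma>1\<^sup>2)\<close> there.\<close>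
  have "\<sigma>1\<^sup>2 < 1" "\<sigma>2\<^sup>2 < 1" using \<sigma> by (simp_all add: abs_square_less_1)
  moreover have "0 \<le> a1 * (1 - \<sigma>1\<^sup>2)" "0 \<le> a2 * (1 - \<sigma>2\<^sup>2)"
    using F1[of "- \<sigma>1" 1 0] F2[of "- \<sigma>2" 1 0] by (simp_all add: algebra_simps)
  ultimately have a_nonneg: "a1 \<ge> 0" "a2 \<ge> 0" by (simp_all add: zero_le_mult_iff)
  have "a1 = 0 \<and> a2 = 0"
    using sector_inequality[OF F1] sector_inequality[OF F2] a_nonneg
    by (intro sqrt_sum_le_1_imp[OF \<sigma> a_nonneg le]) simp_all
  then have a: "a1 = 0" "a2 = 0" by simp_all
  \<comment> \<open>\<open>(-\<sigma>1, 1, 0)\<close> and \<open>(-\<sigma>2, 0, 1)\<close> span the kernel of the degenerate form of the first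
    block; the second block exchanges \<open>\<sigma>1\<close> and \<open>\<sigma>2\<close>.\<close>
  have "dot N (odd1 (- \<sigma>1) 1 0) (odd1 (- \<sigma>1) 1 0) = 0" "dot N (even 1 0) (even 1 0) = 0"
    using Q1[of "- \<sigma>1" 1 0] dot_self_nonneg[of N "odd1 (- \<sigma>1) 1 0"] dot_self_nonneg[of N "even 1 0"]
    by (simp_all add: a)
  moreover have "dot N (odd1 (- \<sigma>2) 0 1) (odd1 (- \<sigma>2) 0 1) = 0" "dot N (even 0 1) (even 0 1) = 0"
      "dot N (p 1 1) (p 1 1) = 0"
    using Q1[of "- \<sigma>2" 0 1] dot_self_nonneg[of N "odd1 (- \<sigma>2) 0 1"] dot_self_nonneg[of N "even 0 1"]
      dot_self_nonneg[of N "p 1 1"] by (simp_all add: a)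
  moreover have "dot N (odd2 (- \<sigma>2) 1 0) (odd2 (- \<sigma>2) 1 0) = 0"
    using Q2[of "- \<sigma>2" 1 0] dot_self_nonneg[of N "odd2 (- \<sigma>2) 1 0"] dot_self_nonneg[of N "even 0 1"]
    by (simp add: a)
  moreover have "dot N (odd2 (- \<sigma>1) 0 1) (odd2 (- \<sigma>1) 0 1) = 0"
    using Q2[of "- \<sigma>1" 0 1] dot_self_nonneg[of N "odd2 (- \<sigma>1) 0 1"] dot_self_nonneg[of N "even 1 0"]
      dot_self_nonneg[of N "p 1 1"] by (simp add: a)
  ultimately have "odd1 (- \<sigma>1) 1 0 n = 0" "even 1 0 n = 0" "odd1 (- \<sigma>2) 0 1 n = 0" "even 0 1 n = 0"
      "p 1 1 n = 0" "odd2 (- \<sigma>2) 1 0 n = 0" "odd2 (- \<sigma>1) 0 1 n = 0"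
    using dot_self_eq_0[OF _ n] by blast+
  then have vals: "p 3 0 n = \<sigma>1 * p 1 0 n" "p 1 2 n = \<sigma>2 * p 1 0 n" "p 0 3 n = \<sigma>2 * p 0 1 n"
      "p 2 1 n = \<sigma>1 * p 0 1 n" "p 2 0 n = 0" "p 1 1 n = 0" "p 0 2 n = 0"
    by (simp_all add: odd1_def odd2_def even_def)
  have high: "p i j n = 0" if "i + j > 3" for i j
    using le_total_degree[of "P n" j i] deg[OF n] that unfolding p_def by fastforce
  have "P n = (\<Sum>j\<le>3. \<Sum>i\<le>3. mon (p i j n) i j)"
    using poly_poly_as_sum_of_mon[OF deg[OF n]] by (simp add: p_def)
  moreover have "{..3} = {0, 1, 2, 3::nat}" by auto
  ultimately have "P n = mon (p 1 0 n) 1 0 + mon (p 0 1 n) 0 1 + mon (p 3 0 n) 3 0 + mon (p 1 2 n) 1 2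
      + mon (p 2 1 n) 2 1 + mon (p 0 3 n) 0 3"
    using vals(5-7) by (simp add: high p00[OF n] numeral_3_eq_3[symmetric] numeral_2_eq_2[symmetric] del: One_nat_def)
  also have "\<dots> = (mon (p 1 0 n) 1 0 + mon (p 0 1 n) 0 1) * g"
    unfolding vals g_def by (simp add: mult_monom distrib_left distrib_right mult.commute)
  finally show ?thesis .
qed


section \<open>Construction above the threshold\<close>

lemma eval2_complex_differentiable:
  "\<exists>a b. (eval2 p has_derivative (\<lambda>h. a * fst h + b * snd h)) (at z)"
proof (induction p)
  case 0
  have "eval2 0 = (\<lambda>_. 0)" by (simp add: fun_eq_iff eval2_simps)
  then show ?case by (intro exI[of _ 0]) simp
next
  case (pCons c p)
  from pCons.IH obtain a b where ab: "(eval2 p has_derivative (\<lambda>h. a * fst h + b * snd h)) (at z)"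
    by blast
  have "(poly c has_derivative (*) (poly (pderiv c) (fst z))) (at (fst z))"
    using poly_DERIV[of c "fst z"] by (simp add: has_field_derivative_def)
  then have "((\<lambda>z. poly c (fst z)) has_derivative (\<lambda>h. poly (pderiv c) (fst z) * fst h)) (at z)"
    by (rule has_derivative_compose[OF has_derivative_fst[OF has_derivative_ident]])
  moreover have "((\<lambda>z. snd z * eval2 p z) has_derivative
      (\<lambda>h. snd z * (a * fst h + b * snd h) + snd h * eval2 p z)) (at z)"
    by (rule has_derivative_mult[OF has_derivative_snd[OF has_derivative_ident] ab])
  ultimately have "((\<lambda>z. poly c (fst z) + snd z * eval2 p z) has_derivative
      (\<lambda>h. poly (pderiv c) (fst z) * fst h + (snd z * (a * fst h + b * snd h) + snd h * eval2 p z))) (at z)"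
    by (rule has_derivative_add)
  moreover have "eval2 (pCons c p) = (\<lambda>z. poly c (fst z) + snd z * eval2 p z)"
    by (simp add: fun_eq_iff eval2_def)
  moreover have "(\<lambda>h. poly (pderiv c) (fst z) * fst h + (snd z * (a * fst h + b * snd h) + snd h * eval2 p z))
     = (\<lambda>h. (poly (pderiv c) (fst z) + snd z * a) * fst h + (snd z * b + eval2 p z) * snd h)"
    by (simp add: fun_eq_iff algebra_simps)
  ultimately show ?case by auto
qed

lemma holomorphic2_on_quotient:
  assumes "\<And>z. z \<in> S \<Longrightarrow> eval2 g z \<noteq> 0"
  shows "holomorphic2_on (\<lambda>z. eval2 p z / eval2 g z) S"
  unfolding holomorphic2_on_def
proof
  fix z assume "z \<in> S"
  then have nz: "eval2 g z \<noteq> 0" by (rule assms)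
  obtain a b where ab: "(eval2 p has_derivative (\<lambda>h. a * fst h + b * snd h)) (at z)"
    using eval2_complex_differentiable by blast
  obtain c d where cd: "(eval2 g has_derivative (\<lambda>h. c * fst h + d * snd h)) (at z)"
    using eval2_complex_differentiable by blast
  have "((\<lambda>z. eval2 p z / eval2 g z) has_derivative
      (\<lambda>h. ((a * fst h + b * snd h) * eval2 g z - eval2 p z * (c * fst h + d * snd h))
        / (eval2 g z * eval2 g z))) (at z)"
    by (rule has_derivative_divide'[OF ab cd nz])
  moreover have "(\<lambda>h. ((a * fst h + b * snd h) * eval2 g z - eval2 p z * (c * fst h + d * snd h))
        / (eval2 g z * eval2 g z))
    = (\<lambda>h. ((a * eval2 g z - c * eval2 p z) / (eval2 g z * eval2 g z)) * fst h
        + ((b * eval2 g z - d * eval2 p z) / (eval2 g z * eval2 g z)) * snd h)"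
    using nz by (simp add: fun_eq_iff field_simps)
  ultimately show "\<exists>a b. ((\<lambda>z. eval2 p z / eval2 g z) has_derivative
      (\<lambda>h. a * fst h + b * snd h)) (at z)" by metis
qed

text \<open>
  The Cholesky factorisation of \<open>v v\<^sup>T + diag(-a, a, e)\<close> in the order \<open>1, p, r\<close>, where
  \<open>v = (1, s, t)\<close>. Its pivots are \<open>b\<close>, \<open>a \<delta> / b\<close> and \<open>e - a t\<^sup>2 / \<delta>\<close>. The monomials of a block
  are \<open>z\<^sub>1\<close> times \<open>1, z\<^sub>1\<^sup>2, z\<^sub>2\<^sup>2\<close>, or \<open>z\<^sub>2\<close> times \<open>1, z\<^sub>2\<^sup>2, z\<^sub>1\<^sup>2\<close>, so \<open>p\<close> and \<open>r\<close> stand for the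
  squares of the two variables.
\<close>

lemma sector_sum_of_squares:
  fixes a e s t b \<delta> :: real and p r :: complex
  assumes b: "b = 1 - a" "b > 0" and \<delta>: "\<delta> = b - s\<^sup>2" "\<delta> > 0"
    and pos: "a > 0" "e - a * t\<^sup>2 / \<delta> > 0"
  shows "(cmod (sqrt b + (s / sqrt b) * p + (t / sqrt b) * r))\<^sup>2
    + (cmod (sqrt (a * \<delta> / b) * p + (sqrt (a * \<delta> / b) * (- s * t / \<delta>)) * r))\<^sup>2
    + (cmod (sqrt (e - a * t\<^sup>2 / \<delta>) * r))\<^sup>2
    = (cmod (1 + s * p + t * r))\<^sup>2 - a + a * (cmod p)\<^sup>2 + e * (cmod r)\<^sup>2"
proof -
  define \<alpha> \<beta> \<gamma> where "\<alpha> = a * \<delta> / b" and "\<beta> = - s * t / \<delta>" and "\<gamma> = e - a * t\<^sup>2 / \<delta>"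
  have s: "s\<^sup>2 = b - \<delta>" using \<delta> by simp
  have a: "a = 1 - b" using b by simp
  have "\<alpha> > 0" "\<gamma> > 0" using assms by (simp_all add: \<alpha>_def \<gamma>_def)
  have 1: "s\<^sup>2 / b + \<alpha> = s\<^sup>2 + a"
    unfolding \<alpha>_def s a using b(2) by (simp add: field_simps)
  have 2: "s * t / b + \<alpha> * \<beta> = s * t"
    unfolding \<alpha>_def \<beta>_def a using b(2) \<delta>(2) by (simp add: field_simps)
  have "\<alpha> * \<beta>\<^sup>2 = a * t\<^sup>2 * (b - \<delta>) / (b * \<delta>)"
    unfolding \<alpha>_def \<beta>_def s[symmetric] using b(2) \<delta>(2) by (simp add: power2_eq_square)
  then have 3: "t\<^sup>2 / b + \<alpha> * \<beta>\<^sup>2 + \<gamma> = t\<^sup>2 + e"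
    unfolding \<gamma>_def a using b(2) \<delta>(2) by (simp add: field_simps)
  have "sqrt b + (s / sqrt b) * p + (t / sqrt b) * r = (b + s * p + t * r) / sqrt b"
    using b(2) by (simp add: field_simps flip: of_real_mult)
  then have "(cmod (sqrt b + (s / sqrt b) * p + (t / sqrt b) * r))\<^sup>2 = (cmod (b + s * p + t * r))\<^sup>2 / b"
    using b(2) by (simp add: norm_divide power_divide)
  moreover have "(cmod (sqrt \<alpha> * p + (sqrt \<alpha> * \<beta>) * r))\<^sup>2 = \<alpha> * (cmod (p + \<beta> * r))\<^sup>2"
  proof -
    have "sqrt \<alpha> * p + (sqrt \<alpha> * \<beta>) * r = sqrt \<alpha> * (p + \<beta> * r)" by (simp add: algebra_simps)
    then show ?thesis using \<open>\<alpha> > 0\<close> by (simp add: norm_mult power_mult_distrib)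
  qed
  moreover have "(cmod (sqrt \<gamma> * r))\<^sup>2 = \<gamma> * (cmod r)\<^sup>2"
    using \<open>\<gamma> > 0\<close> by (simp add: norm_mult power_mult_distrib)
  moreover have "(cmod (b + s * p + t * r))\<^sup>2 / b + \<alpha> * (cmod (p + \<beta> * r))\<^sup>2 + \<gamma> * (cmod r)\<^sup>2
      = b + 2 * s * Re p + 2 * t * Re r + (s\<^sup>2 / b + \<alpha>) * (cmod p)\<^sup>2
        + 2 * (s * t / b + \<alpha> * \<beta>) * (Re p * Re r + Im p * Im r)
        + (t\<^sup>2 / b + \<alpha> * \<beta>\<^sup>2 + \<gamma>) * (cmod r)\<^sup>2"
    unfolding cmod_power2 using b(2) by (simp add: power2_eq_square field_simps)
  moreover have "\<dots> = (cmod (1 + s * p + t * r))\<^sup>2 - a + a * (cmod p)\<^sup>2 + e * (cmod r)\<^sup>2"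
    unfolding 1 2 3 unfolding b(1) cmod_power2 by (simp add: power2_eq_square algebra_simps)
  ultimately show ?thesis unfolding \<alpha>_def \<beta>_def \<gamma>_def by simp
qed

text \<open>
  In the direction \<open>(x, y)\<close> both linearised inequalities \<open>\<kappa> a1 < 2 x\<^sup>2 a2\<close>, \<open>\<kappa> a2 < 2 y\<^sup>2 a1\<close>
  become \<open>\<kappa> < 2 x y\<close>. For \<open>(a1, a2) = \<tau> (x, y)\<close> the exact ones are \<open>\<tau> (x + 2 y) < \<delta>\<close> and
  \<open>\<tau> (y + 2 x) < \<delta>\<close> with \<open>\<delta> = (x + y)\<^sup>2 - 1\<close>; as \<open>x, y \<le> 1\<close>, the choice \<open>\<tau> = \<delta> / 4\<close> works.
\<close>

lemma sqrt_sum_gt_1_imp: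
  fixes \<sigma>1 \<sigma>2 :: real
  assumes "0 \<le> \<sigma>1" "\<sigma>1 < 1" "0 \<le> \<sigma>2" "\<sigma>2 < 1"
    and gt: "sqrt (1 - \<sigma>1 ^ 2) + sqrt (1 - \<sigma>2 ^ 2) > 1"
  obtains a1 a2 where "a1 > 0" "a2 > 0"
    "a1 * \<sigma>2\<^sup>2 < (a1 + 2 * a2) * (1 - a1 - \<sigma>1\<^sup>2)" "a2 * \<sigma>1\<^sup>2 < (a2 + 2 * a1) * (1 - a2 - \<sigma>2\<^sup>2)"
proof -
  define x y where "x = sqrt (1 - \<sigma>1 ^ 2)" and "y = sqrt (1 - \<sigma>2 ^ 2)"
  have "\<sigma>1\<^sup>2 < 1" "\<sigma>2\<^sup>2 < 1" using assms by (simp_all add: abs_square_less_1)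
  then have pos: "x > 0" "y > 0" and sq: "\<sigma>1\<^sup>2 = 1 - x\<^sup>2" "\<sigma>2\<^sup>2 = 1 - y\<^sup>2" and le: "x \<le> 1" "y \<le> 1"
    by (simp_all add: x_def y_def)
  define \<delta> where "\<delta> = (x + y)\<^sup>2 - 1"
  have "\<delta> > 0" using gt by (simp add: \<delta>_def x_def y_def)
  have small: "(\<delta> / 4) * (u + 2 * v) < \<delta>" if "u \<le> 1" "v \<le> 1" for u v :: real
    using mult_strict_left_mono[of "u + 2 * v" 4 "\<delta> / 4"] that \<open>\<delta> > 0\<close> by simp
  have key: "\<delta> / 4 * u * (1 - v\<^sup>2) < (\<delta> / 4 * u + 2 * (\<delta> / 4 * v)) * (1 - \<delta> / 4 * u - (1 - u\<^sup>2))"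
    if "u > 0" "u \<le> 1" "v \<le> 1" "\<delta> = (u + v)\<^sup>2 - 1" for u v
  proof -
    have "(\<delta> / 4 * u + 2 * (\<delta> / 4 * v)) * (1 - \<delta> / 4 * u - (1 - u\<^sup>2)) - \<delta> / 4 * u * (1 - v\<^sup>2)
      = (\<delta> / 4 * u) * (((u + v)\<^sup>2 - 1) - (\<delta> / 4) * (u + 2 * v))"
      by (simp add: power2_eq_square field_simps)
    also have "\<dots> > 0"
      using small[OF that(2,3)] \<open>\<delta> > 0\<close> that(1) that(4)[symmetric] by simp
    finally show ?thesis by simp
  qed
  show ?thesis
  proof (rule that[of "\<delta> / 4 * x" "\<delta> / 4 * y"])
    show "\<delta> / 4 * x > 0" "\<delta> / 4 * y > 0" using \<open>\<delta> > 0\<close> pos by simp_all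
    show "\<delta> / 4 * x * \<sigma>2\<^sup>2 < (\<delta> / 4 * x + 2 * (\<delta> / 4 * y)) * (1 - \<delta> / 4 * x - \<sigma>1\<^sup>2)"
      unfolding sq using key pos le by (simp add: \<delta>_def)
    show "\<delta> / 4 * y * \<sigma>1\<^sup>2 < (\<delta> / 4 * y + 2 * (\<delta> / 4 * x)) * (1 - \<delta> / 4 * y - \<sigma>2\<^sup>2)"
      unfolding sq using key[of y x] pos le by (simp add: \<delta>_def add.commute)
  qed
qed


lemma dvd_mon_cong:
  assumes "d dvd mon c i j" "c \<noteq> 0"
  shows "d dvd mon c' i j"
proof -
  have "mon c' i j = mon c i j * mon (c' / c) 0 0" using assms(2) by (simp add: mult_monom)
  then show ?thesis using assms(1) by simp
qed

text \<open>
  The three squares of each block are the squared moduli of three components. The last two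
  components of each block are free of linear terms, and since all pivots are positive, a common
  divisor of these four divides \<open>z\<^sub>1\<^sup>3\<close> and \<open>z\<^sub>2\<^sup>3\<close>.
\<close>

lemma exists_reduced_cubic_sphere_map:
  fixes \<sigma>1 \<sigma>2 :: real
  assumes \<sigma>: "0 \<le> \<sigma>1" "\<sigma>1 < 1" "0 \<le> \<sigma>2" "\<sigma>2 < 1"
    and g_def: "g = mon 1 0 0 + mon (complex_of_real \<sigma>1) 2 0 + mon (complex_of_real \<sigma>2) 0 2"
    and gt: "sqrt (1 - \<sigma>1 ^ 2) + sqrt (1 - \<sigma>2 ^ 2) > 1"
  shows "\<exists>(N :: nat) P. (\<forall>k<N. eval2 (P k) 0 = 0) \<and> map_degree N P = 3 \<and>
            sphere_map N P g \<and> reduced_fraction N P g"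
proof -
  obtain a1 a2 where a: "a1 > 0" "a2 > 0"
    and ineq: "a1 * \<sigma>2\<^sup>2 < (a1 + 2 * a2) * (1 - a1 - \<sigma>1\<^sup>2)"
      "a2 * \<sigma>1\<^sup>2 < (a2 + 2 * a1) * (1 - a2 - \<sigma>2\<^sup>2)"
    by (rule sqrt_sum_gt_1_imp[OF \<sigma> gt])
  define b1 b2 where "b1 = 1 - a1" and "b2 = 1 - a2"
  define \<delta>1 \<delta>2 where "\<delta>1 = b1 - \<sigma>1\<^sup>2" and "\<delta>2 = b2 - \<sigma>2\<^sup>2"
  define \<alpha>1 \<alpha>2 where "\<alpha>1 = sqrt (a1 * \<delta>1 / b1)" and "\<alpha>2 = sqrt (a2 * \<delta>2 / b2)"
  define \<beta>1 \<beta>2 where "\<beta>1 = - \<sigma>1 * \<sigma>2 / \<delta>1" and "\<beta>2 = - \<sigma>2 * \<sigma>1 / \<delta>2"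
  define \<gamma>1 \<gamma>2 where "\<gamma>1 = sqrt (a1 + 2 * a2 - a1 * \<sigma>2\<^sup>2 / \<delta>1)"
    and "\<gamma>2 = sqrt (a2 + 2 * a1 - a2 * \<sigma>1\<^sup>2 / \<delta>2)"
  have \<delta>: "\<delta>1 > 0" "\<delta>2 > 0"
  proof -
    have "0 < (a1 + 2 * a2) * \<delta>1" "0 < (a2 + 2 * a1) * \<delta>2"
      using ineq a by (auto simp: \<delta>1_def \<delta>2_def b1_def b2_def intro: le_less_trans[rotated])
    then show "\<delta>1 > 0" "\<delta>2 > 0" using a by (simp_all add: zero_less_mult_iff)
  qed
  then have b: "b1 > 0" "b2 > 0"
    using zero_le_power2[of \<sigma>1] zero_le_power2[of \<sigma>2] unfolding \<delta>1_def \<delta>2_def by linarith+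
  have \<gamma>_arg: "a1 + 2 * a2 - a1 * \<sigma>2\<^sup>2 / \<delta>1 > 0" "a2 + 2 * a1 - a2 * \<sigma>1\<^sup>2 / \<delta>2 > 0"
    using ineq \<delta> unfolding \<delta>1_def[symmetric] \<delta>2_def[symmetric] b1_def[symmetric] b2_def[symmetric]
    by (simp_all add: pos_divide_less_eq)
  have nz: "\<alpha>1 > 0" "\<alpha>2 > 0" "\<gamma>1 > 0" "\<gamma>2 > 0"
    unfolding \<alpha>1_def \<alpha>2_def \<gamma>1_def \<gamma>2_def using a b \<delta> \<gamma>_arg by simp_all
  define L where "L =
    [mon (sqrt b1) 1 0 + mon (\<sigma>1 / sqrt b1) 3 0 + mon (\<sigma>2 / sqrt b1) 1 2,
     mon \<alpha>1 3 0 + mon (\<alpha>1 * \<beta>1) 1 2,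
     mon \<gamma>1 1 2,
     mon (sqrt b2) 0 1 + mon (\<sigma>2 / sqrt b2) 0 3 + mon (\<sigma>1 / sqrt b2) 2 1,
     mon \<alpha>2 0 3 + mon (\<alpha>2 * \<beta>2) 2 1,
     mon \<gamma>2 2 1]"
  define P where "P = (\<lambda>k. L ! k)"
  have P: "P 0 = mon (sqrt b1) 1 0 + mon (\<sigma>1 / sqrt b1) 3 0 + mon (\<sigma>2 / sqrt b1) 1 2"
    "P 1 = mon \<alpha>1 3 0 + mon (\<alpha>1 * \<beta>1) 1 2" "P 2 = mon \<gamma>1 1 2"
    "P 3 = mon (sqrt b2) 0 1 + mon (\<sigma>2 / sqrt b2) 0 3 + mon (\<sigma>1 / sqrt b2) 2 1"
    "P 4 = mon \<alpha>2 0 3 + mon (\<alpha>2 * \<beta>2) 2 1" "P 5 = mon \<gamma>2 2 1"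
    by (simp_all add: P_def L_def)
  have six: "{..<6} = {0, 1, 2, 3, 4, 5::nat}" by auto
  have all_six: "(\<forall>k<6. Q k) \<longleftrightarrow> Q 0 \<and> Q 1 \<and> Q 2 \<and> Q 3 \<and> Q 4 \<and> Q (5::nat)" for Q
  proof -
    have "(\<forall>k<6. Q k) \<longleftrightarrow> (\<forall>k\<in>{..<6}. Q k)" by auto
    then show ?thesis unfolding six by simp
  qed
  have origin: "\<forall>k<6. eval2 (P k) 0 = 0"
    unfolding all_six P by (simp add: eval2_simps eval2_mon)
  have low: "\<forall>k<6. total_degree (P k) \<le> 3"
    unfolding all_six P
    by (intro conjI total_degree_leI) (auto split: if_splits)
  have "3 \<le> total_degree (P 1)"
    using le_total_degree[of "P 1" 0 3] nz unfolding P by simp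
  then have "total_degree (P 1) = 3" using low by (simp add: antisym)
  then have "3 \<in> (\<lambda>k. total_degree (P k)) ` {..<6}" by (intro image_eqI[of _ _ 1]) simp_all
  then have "Max (insert 0 ((\<lambda>k. total_degree (P k)) ` {..<6})) = 3"
  proof (intro Max_eqI)
    fix n assume "n \<in> insert 0 ((\<lambda>k. total_degree (P k)) ` {..<6})"
    then show "n \<le> 3" using low by blast
  next
    show "3 \<in> insert 0 ((\<lambda>k. total_degree (P k)) ` {..<6})"
      using \<open>3 \<in> _\<close> by (rule insertI2)
  qed (intro finite.insertI finite_imageI finite_lessThan)
  then have "map_degree 6 P = 3" unfolding map_degree_def .
  moreover have "sphere_map 6 P g"
    unfolding sphere_map_def
  proof
    have "eval2 g z \<noteq> 0" if "z \<in> ball 0 1" for z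
    proof
      assume "eval2 g z = 0"
      then have "1 + \<sigma>1 * fst z ^ 2 + \<sigma>2 * snd z ^ 2 = 0"
        by (simp add: g_def eval2_simps eval2_mon)
      then have "\<sigma>1 * fst z ^ 2 + \<sigma>2 * snd z ^ 2 = - 1"
        by (simp add: eq_neg_iff_add_eq_0 add_ac)
      then have "1 = cmod (\<sigma>1 * fst z ^ 2 + \<sigma>2 * snd z ^ 2)" by simp
      also have "\<dots> \<le> \<sigma>1 * (cmod (fst z))\<^sup>2 + \<sigma>2 * (cmod (snd z))\<^sup>2"
        using norm_triangle_ineq[of "\<sigma>1 * fst z ^ 2" "\<sigma>2 * snd z ^ 2"] \<sigma>
        by (simp add: norm_mult norm_power)
      also have "\<dots> \<le> 1 * (cmod (fst z))\<^sup>2 + 1 * (cmod (snd z))\<^sup>2"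
        using \<sigma> by (intro add_mono mult_right_mono) auto
      also have "\<dots> = (norm z)\<^sup>2" by (simp add: norm_prod_def)
      also have "\<dots> < 1" using that by (simp add: abs_square_less_1)
      finally show False by simp
    qed
    then have "holomorphic2_on (\<lambda>z. eval2 (P k) z / eval2 g z) (ball 0 1)"
      "\<forall>z\<in>ball 0 1. eval2 (P k) z / eval2 g z * eval2 g z = eval2 (P k) z" for k
      by (auto intro: holomorphic2_on_quotient)
    moreover have "coeff (coeff g 0) 0 = 1" by (simp add: g_def)
    then have "g \<noteq> 0" by auto
    ultimately show "rational_holomorphic_on 6 P g (ball 0 1)"
      unfolding rational_holomorphic_on_def
      by (intro conjI exI[of _ "\<lambda>k z. eval2 (P k) z / eval2 g z"]) auto
    show "\<forall>z\<in>sphere 0 1. (\<Sum>k<6. (cmod (eval2 (P k) z))\<^sup>2) = (cmod (eval2 g z))\<^sup>2"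
    proof
      fix z :: "complex \<times> complex" assume "z \<in> sphere 0 1"
      then have "(norm z)\<^sup>2 = 1" by simp
      then have AB: "(cmod (fst z))\<^sup>2 + (cmod (snd z))\<^sup>2 = 1" by (simp add: norm_prod_def)
      define p r where "p = fst z ^ 2" and "r = snd z ^ 2"
      define A B where "A = cmod p" and "B = cmod r"
      have g: "eval2 g z = 1 + \<sigma>1 * p + \<sigma>2 * r"
        by (simp add: g_def eval2_simps eval2_mon p_def r_def)
      have A: "(cmod (fst z * w))\<^sup>2 = A * (cmod w)\<^sup>2" and B: "(cmod (snd z * w))\<^sup>2 = B * (cmod w)\<^sup>2" for w
        by (simp_all add: A_def B_def p_def r_def norm_mult norm_power power_mult_distrib)
      have "eval2 (P 0) z = fst z * (sqrt b1 + (\<sigma>1 / sqrt b1) * p + (\<sigma>2 / sqrt b1) * r)"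
        "eval2 (P 1) z = fst z * (\<alpha>1 * p + (\<alpha>1 * \<beta>1) * r)"
        "eval2 (P 2) z = fst z * (\<gamma>1 * r)"
        "eval2 (P 3) z = snd z * (sqrt b2 + (\<sigma>2 / sqrt b2) * r + (\<sigma>1 / sqrt b2) * p)"
        "eval2 (P 4) z = snd z * (\<alpha>2 * r + (\<alpha>2 * \<beta>2) * p)"
        "eval2 (P 5) z = snd z * (\<gamma>2 * p)"
        unfolding P p_def r_def
        by (simp_all add: eval2_simps eval2_mon distrib_left power3_eq_cube power2_eq_square mult_ac)
      then have "(\<Sum>k<6. (cmod (eval2 (P k) z))\<^sup>2)
        = A * ((cmod (sqrt b1 + (\<sigma>1 / sqrt b1) * p + (\<sigma>2 / sqrt b1) * r))\<^sup>2
            + (cmod (\<alpha>1 * p + (\<alpha>1 * \<beta>1) * r))\<^sup>2 + (cmod (\<gamma>1 * r))\<^sup>2)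
        + B * ((cmod (sqrt b2 + (\<sigma>2 / sqrt b2) * r + (\<sigma>1 / sqrt b2) * p))\<^sup>2
            + (cmod (\<alpha>2 * r + (\<alpha>2 * \<beta>2) * p))\<^sup>2 + (cmod (\<gamma>2 * p))\<^sup>2)"
        unfolding six by (simp add: A B distrib_left[where 'a = real] del: One_nat_def)
      also have "\<dots> = A * ((cmod (1 + \<sigma>1 * p + \<sigma>2 * r))\<^sup>2 - a1 + a1 * (cmod p)\<^sup>2 + (a1 + 2 * a2) * (cmod r)\<^sup>2)
        + B * ((cmod (1 + \<sigma>2 * r + \<sigma>1 * p))\<^sup>2 - a2 + a2 * (cmod r)\<^sup>2 + (a2 + 2 * a1) * (cmod p)\<^sup>2)"
        using sector_sum_of_squares[OF b1_def b(1) \<delta>1_def \<delta>(1) a(1) \<gamma>_arg(1), of p r]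
          sector_sum_of_squares[OF b2_def b(2) \<delta>2_def \<delta>(2) a(2) \<gamma>_arg(2), of r p]
        unfolding \<alpha>1_def \<alpha>2_def \<beta>1_def \<beta>2_def \<gamma>1_def \<gamma>2_def by presburger
      also have "\<dots> = A * ((cmod (eval2 g z))\<^sup>2 - a1 + a1 * A\<^sup>2 + (a1 + 2 * a2) * B\<^sup>2)
        + B * ((cmod (eval2 g z))\<^sup>2 - a2 + a2 * B\<^sup>2 + (a2 + 2 * a1) * A\<^sup>2)"
        by (simp add: g A_def B_def ac_simps)
      also have "\<dots> = (A + B) * (cmod (eval2 g z))\<^sup>2 + ((A + B)\<^sup>2 - 1) * (a1 * A + a2 * B)"
        by (simp add: power2_eq_square algebra_simps)
      also have "A + B = 1" using AB by (simp add: A_def B_def p_def r_def norm_power)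
      finally show "(\<Sum>k<6. (cmod (eval2 (P k) z))\<^sup>2) = (cmod (eval2 g z))\<^sup>2" by simp
    qed
  qed
  moreover have "reduced_fraction 6 P g"
    unfolding reduced_fraction_def
  proof (intro allI impI)
    fix d assume "d dvd g \<and> (\<forall>k<6. d dvd P k)"
    then have dvd: "d dvd P 1" "d dvd P 2" "d dvd P 4" "d dvd P 5" by auto
    have "d dvd mon (\<alpha>1 * \<beta>1) 1 2" "d dvd mon (\<alpha>2 * \<beta>2) 2 1"
      using dvd_mon_cong[OF dvd(2)[unfolded P]] dvd_mon_cong[OF dvd(4)[unfolded P]] nz by simp_all
    then have "d dvd mon \<alpha>1 3 0" "d dvd mon \<alpha>2 0 3"
      using dvd(1,3) unfolding P by (simp_all add: dvd_add_left_iff)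
    then have "d dvd mon 1 3 0" "d dvd mon 1 0 3"
      using nz dvd_mon_cong[of d \<alpha>1 3 0 1] dvd_mon_cong[of d \<alpha>2 0 3 1]
      by (simp_all only: of_real_eq_0_iff less_irrefl not_False_eq_True order_less_imp_not_eq2)
    then show "total_degree d = 0" by (rule total_degree_common_divisor_of_powers)
  qed
  ultimately show ?thesis using origin by blast
qed

theorem theorem1p1:
  fixes \<sigma>1 \<sigma>2 :: real and g :: "complex poly poly"
  assumes "0 \<le> \<sigma>1" "\<sigma>1 < 1" "0 \<le> \<sigma>2" "\<sigma>2 < 1"
    and "g = 1 + Const (complex_of_real \<sigma>1) * Z1 ^ 2 + Const (complex_of_real \<sigma>2) * Z2 ^ 2"
  shows "(\<exists>(N :: nat) (P :: nat \<Rightarrow> complex poly poly).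
            (\<forall>k<N. eval2 (P k) 0 = 0) \<and> map_degree N P = 3 \<and>
            sphere_map N P g \<and> reduced_fraction N P g)
         \<longleftrightarrow>
         (0 \<le> \<sigma>1 \<and> \<sigma>1 < 1 \<and> 0 \<le> \<sigma>2 \<and> \<sigma>2 < 1 \<and>
          sqrt (1 - \<sigma>1 ^ 2) + sqrt (1 - \<sigma>2 ^ 2) > 1)" (is "?L \<longleftrightarrow> ?R")
proof
  have g: "g = mon 1 0 0 + mon (complex_of_real \<sigma>1) 2 0 + mon (complex_of_real \<sigma>2) 0 2"
    unfolding assms(5) by (rule quadratic_denominator_as_monomials)
  show ?L if ?R
    using exists_reduced_cubic_sphere_map[OF assms(1-4) g] that by blast
  show ?R if ?L
  proof (rule ccontr)
    assume "\<not> ?R"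
    then have le: "sqrt (1 - \<sigma>1 ^ 2) + sqrt (1 - \<sigma>2 ^ 2) \<le> 1" using assms(1-4) by auto
    from \<open>?L\<close> obtain N P where origin: "\<forall>k<N. eval2 (P k) 0 = 0" and deg: "map_degree N P = 3"
      and sphere: "sphere_map N P g" and reduced: "reduced_fraction N P g" by blast
    have low: "\<forall>k<N. total_degree (P k) \<le> 3"
      unfolding deg[symmetric] map_degree_def by (auto intro!: Max_ge)
    have const: "\<forall>k<N. coeff (coeff (P k) 0) 0 = 0"
      using origin by (simp add: eval2_def poly_0_coeff_0)
    have identity: "\<forall>z\<in>sphere 0 1. (\<Sum>k<N. (cmod (eval2 (P k) z))\<^sup>2) = (cmod (eval2 g z))\<^sup>2"
      using sphere unfolding sphere_map_def by (rule conjunct2)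
    note rigid = cubic_sphere_map_rigidity[where p = "\<lambda>i j n. coeff (coeff (P n) j) i",
        OF g refl low const identity assms(1-4) le]
    have "g dvd P k" if "k < N" for k
      by (rule dvdI[OF trans[OF rigid[OF that] mult.commute]])
    then have "g dvd g \<and> (\<forall>k<N. g dvd P k)" by simp
    with reduced[unfolded reduced_fraction_def, THEN spec, of g] have "total_degree g = 0"
      by (rule mp)
    then have "coeff (coeff g 0) 2 = 0" "coeff (coeff g 2) 0 = 0"
      using le_total_degree[of g 0 2] le_total_degree[of g 2 0] by auto
    then have "\<sigma>1 = 0" "\<sigma>2 = 0" by (simp_all add: g)
    then show False using le by simp
  qed
qed

end
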